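(* There is an absolute constant $C>0$ such that for every real number $0<\alpha<1$ and every positive integer $N$, \[ \mathrm{RLGP}(\mathbb{Q},N,\alpha)\geq C(1-\alpha)\frac{\log N}{\log\log N}. \]
   Context: For a field $\mathbb{F}$, a finite set $Y\subseteq\mathbb{F}$ and $0<\alpha\leq 1$, a line $\ell$ in $\mathbb{F}^2$ is called $\alpha$-rich in $Y\times Y$ if $|\ell\cap(Y\times Y)|\geq\alpha|Y|$. A set of lines is in general position if no two of them are parallel and no three of them pass through a common point. $\mathrm{RLGP}(Y,\alpha)$ denotes the maximum number of lines that are $\alpha$-rich in $Y\times Y$ and in general position, and $\mathrm{RLGP}(\mathbb{F},N,\alpha):=\max_{Y\subseteq\mathbb{F},\,|Y|=N}\mathrm{RLGP}(Y,\alpha)$. *)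

theory Defs
  imports Complex_Main
begin

definition is_line :: "('a::field \<times> 'a) set \<Rightarrow> bool" where
  "is_line l \<longleftrightarrow> (\<exists>a b c. (a \<noteq> 0 \<or> b \<noteq> 0) \<and> l = {(x, y). a * x + b * y = c})"

definition parallel_lines :: "('a::field \<times> 'a) set \<Rightarrow> ('a \<times> 'a) set \<Rightarrow> bool" where
  "parallel_lines l m \<longleftrightarrow> l = m \<or> l \<inter> m = {}"

definition rich :: "'a::field set \<Rightarrow> real \<Rightarrow> ('a \<times> 'a) set \<Rightarrow> bool" where
  "rich Y \<alpha> l \<longleftrightarrow> real (card (l \<inter> (Y \<times> Y))) \<ge> \<alpha> * real (card Y)"

definition general_position :: "('a::field \<times> 'a) set set \<Rightarrow> bool" where
  "general_position L \<longleftrightarrow>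
     pairwise (\<lambda>l m. \<not> parallel_lines l m) L \<and>
     (\<forall>l\<in>L. \<forall>m\<in>L. \<forall>k\<in>L. l \<noteq> m \<and> m \<noteq> k \<and> l \<noteq> k \<longrightarrow> l \<inter> m \<inter> k = {})"

text \<open>For finite nonempty \<open>Y\<close> and positive \<open>\<alpha>\<close> the maximum is attained: a rich line
  contains a point of \<open>Y \<times> Y\<close>, and each point lies on at most two lines of a family in
  general position, so every admissible family is finite, with at most
  \<open>2 * (card Y)^2\<close> members.\<close>

definition RLGP :: "'a::field set \<Rightarrow> real \<Rightarrow> nat" where
  "RLGP Y \<alpha> = Max {card L | L. (\<forall>l\<in>L. is_line l \<and> rich Y \<alpha> l) \<and> general_position L}"

text \<open>The first argument only selects the field, as in \<open>RLGP_field TYPE(rat) N \<alpha>\<close>.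
  The maximum is meant for \<open>0 < N\<close> and fields with at least \<open>N\<close> elements.\<close>

definition RLGP_field :: "'a::field itself \<Rightarrow> nat \<Rightarrow> real \<Rightarrow> nat" where
  "RLGP_field _ N \<alpha> = Max {RLGP Y \<alpha> | Y :: 'a set. finite Y \<and> card Y = N}"

end

theory Submission
  imports Defs "HOL-Computational_Algebra.Primes"
begin

text \<open>The lines are \<open>y = i x + i\<^sup>2 w\<close> for \<open>i = 1, \<dots>, k\<close>; as the points \<open>(i, i\<^sup>2 w)\<close> lie on a
  parabola, no three of the lines concur. The set \<open>Y\<close> consists of the numbers \<open>u (1 + B m)\<close> with
  \<open>u dvd B\<close> and \<open>m < M\<close>, and \<open>w = B\<^sup>2\<close>: if also \<open>i u dvd B\<close>, then such a number is mapped to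
  \<open>i u (1 + B m')\<close> with \<open>m'\<close> slightly larger than \<open>m\<close>. Here \<open>B\<close> is the product over the primes
  \<open>p \<le> k\<close> of the largest power of \<open>p\<close> not exceeding \<open>k ^ L\<close>. Multiplication by \<open>p\<close> leads at most a
  proportion \<open>ln p / ln (k ^ L)\<close> of the divisors of \<open>B\<close> out of the set of divisors; this bound is
  additive along the factorisation of \<open>i\<close>, so multiplication by \<open>i \<le> k\<close> loses a proportion of at most
  \<open>1 / L\<close>. With \<open>L\<close> of order \<open>1 / (1 - \<alpha>)\<close> the construction fits into \<open>N\<close> elements as soon as
  \<open>k ln k\<close> is at most a small multiple of \<open>(1 - \<alpha>) ln N\<close>.\<close>

section \<open>Finiteness of the families of rich lines, and lower bounds for the maxima\<close>

lemma card_le_two_if_no_three: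
  assumes "finite A"
    and "\<And>x y z. x \<in> A \<Longrightarrow> y \<in> A \<Longrightarrow> z \<in> A \<Longrightarrow> x \<noteq> y \<Longrightarrow> y \<noteq> z \<Longrightarrow> x \<noteq> z \<Longrightarrow> False"
  shows "card A \<le> 2"
proof (rule ccontr)
  assume "\<not> card A \<le> 2"
  then have "3 \<le> card A" by simp
  then obtain T where "T \<subseteq> A" "card T = 3"
    using obtain_subset_with_card_n by metis
  then obtain x y z where "T = {x, y, z}" "x \<noteq> y" "y \<noteq> z" "x \<noteq> z"
    by (auto simp: card_3_iff)
  with \<open>T \<subseteq> A\<close> assms(2) show False by auto
qed

text \<open>Every rich line meets the grid, and every grid point lies on at most two of the lines.
  The bound makes the set under the \<open>Max\<close> in \<open>RLGP\<close> finite; an infinite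
  \<open>L\<close> has \<open>card L = 0\<close>.\<close>

lemma card_rich_general_position_le:
  fixes Y :: "'a::field set"
  assumes fin: "finite Y" and Y: "card Y > 0" and \<alpha>: "\<alpha> > 0"
    and rich: "\<forall>l\<in>L. rich Y \<alpha> l" and gp: "general_position L"
  shows "card L \<le> 2 * (card Y)\<^sup>2"
proof (cases "finite L")
  case finL: True
  define F where "F q = {l \<in> L. q \<in> l}" for q
  have F2: "card (F q) \<le> 2" for q
  proof (rule card_le_two_if_no_three)
    fix l m k assume a: "l \<in> F q" "m \<in> F q" "k \<in> F q" "l \<noteq> m" "m \<noteq> k" "l \<noteq> k"
    with gp have "l \<inter> m \<inter> k = {}"
      unfolding general_position_def F_def by blast
    with a show False by (auto simp: F_def)
  qed (use finL in \<open>simp add: F_def\<close>)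
  have "L \<subseteq> (\<Union>q\<in>Y \<times> Y. F q)"
  proof
    fix l assume l: "l \<in> L"
    have "0 < \<alpha> * real (card Y)" using \<alpha> Y by simp
    also have "\<dots> \<le> real (card (l \<inter> (Y \<times> Y)))"
      using rich l by (auto simp: rich_def)
    finally have "l \<inter> (Y \<times> Y) \<noteq> {}" by auto
    then show "l \<in> (\<Union>q\<in>Y \<times> Y. F q)" using l by (auto simp: F_def)
  qed
  then have "card L \<le> card (\<Union>q\<in>Y \<times> Y. F q)"
    using finL fin by (intro card_mono) (auto simp: F_def)
  also have "\<dots> \<le> (\<Sum>q\<in>Y \<times> Y. card (F q))"
    using fin by (intro card_UN_le) auto
  also have "\<dots> \<le> (\<Sum>q\<in>Y \<times> Y. 2)" by (intro sum_mono F2)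
  also have "\<dots> = 2 * (card Y)\<^sup>2" by (simp add: card_cartesian_product power2_eq_square)
  finally show ?thesis .
qed simp

lemma RLGP_ge:
  assumes "finite Y" "card Y > 0" "\<alpha> > 0"
    and "\<forall>l\<in>L. is_line l \<and> rich Y \<alpha> l" "general_position L"
  shows "card L \<le> RLGP Y \<alpha>"
  unfolding RLGP_def
proof (rule Max_ge)
  have "{card L | L. (\<forall>l\<in>L. is_line l \<and> rich Y \<alpha> l) \<and> general_position L} \<subseteq> {..2 * (card Y)\<^sup>2}"
    using card_rich_general_position_le[OF assms(1-3)] by auto
  then show "finite {card L | L. (\<forall>l\<in>L. is_line l \<and> rich Y \<alpha> l) \<and> general_position L}"
    by (rule finite_subset) simp
qed (use assms in auto)

text \<open>The bound depends on \<open>card Y\<close> alone, so it also makes the set under the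
  outer \<open>Max\<close> in \<open>RLGP_field\<close> finite.\<close>

lemma RLGP_le:
  fixes Y :: "'a::field set"
  assumes "finite Y" "card Y > 0" "\<alpha> > 0"
  shows "RLGP Y \<alpha> \<le> 2 * (card Y)\<^sup>2"
proof -
  let ?S = "{card L | L :: ('a \<times> 'a) set set. (\<forall>l\<in>L. is_line l \<and> rich Y \<alpha> l) \<and> general_position L}"
  have sub: "?S \<subseteq> {..2 * (card Y)\<^sup>2}"
    using card_rich_general_position_le[OF assms] by auto
  have "finite ?S" using sub by (rule finite_subset) simp
  moreover have "card {} \<in> ?S"
    by (rule CollectI, rule exI[of _ "{}"]) (simp add: general_position_def)
  ultimately have "Max ?S \<in> ?S" by (intro Max_in) auto
  with sub show ?thesis unfolding RLGP_def by blast
qed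

lemma RLGP_field_ge:
  fixes Y :: "'a::field set"
  assumes "finite Y" "card Y = N" "N > 0" "\<alpha> > 0"
    and "\<forall>l\<in>L. is_line l \<and> rich Y \<alpha> l" "general_position L"
  shows "card L \<le> RLGP_field TYPE('a) N \<alpha>"
proof -
  have "card L \<le> RLGP Y \<alpha>" using assms by (intro RLGP_ge) auto
  also have "\<dots> \<le> RLGP_field TYPE('a) N \<alpha>"
    unfolding RLGP_field_def
  proof (rule Max_ge)
    have "{RLGP Y \<alpha> | Y :: 'a set. finite Y \<and> card Y = N} \<subseteq> {..2 * N\<^sup>2}"
      using RLGP_le[of _ \<alpha>] assms(3,4) by auto
    then show "finite {RLGP Y \<alpha> | Y :: 'a set. finite Y \<and> card Y = N}"
      by (rule finite_subset) simp
  qed (use assms in auto)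
  finally show ?thesis .
qed

section \<open>A family of lines in general position\<close>

text \<open>Over the rationals and for \<open>w \<noteq> 0\<close>, the tangent of slope
  \<open>a\<close> to the parabola \<open>x\<^sup>2 = - 4 * w * y\<close>.\<close>

definition parabola_line :: "'a::field \<Rightarrow> 'a \<Rightarrow> ('a \<times> 'a) set" where
  "parabola_line w a = {(x, y). y = a * x + a\<^sup>2 * w}"

lemma is_line_parabola_line: "is_line (parabola_line w a)"
  unfolding is_line_def parabola_line_def
  by (rule exI[of _ a], rule exI[of _ "-1"], rule exI[of _ "- (a\<^sup>2 * w)"])
    (auto simp: eq_neg_iff_add_eq_0 diff_add_eq)

lemma inj_parabola_line: "inj (parabola_line w)"
proof (rule injI)
  fix a b assume eq: "parabola_line w a = parabola_line w b"
  have "(0, a\<^sup>2 * w) \<in> parabola_line w b" "(1, a + a\<^sup>2 * w) \<in> parabola_line w b"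
    unfolding eq[symmetric] by (auto simp: parabola_line_def)
  then show "a = b" by (auto simp: parabola_line_def)
qed

text \<open>Lines of slopes \<open>a \<noteq> b\<close> meet where \<open>x = - (a + b) * w\<close>.
  If a third line of slope \<open>c\<close> passed through that point, then
  \<open>a + b = a + c\<close>.\<close>

lemma general_position_parabola_line:
  assumes "w \<noteq> 0"
  shows "general_position (parabola_line w ` A)"
proof -
  have meet: "parabola_line w a \<inter> parabola_line w b \<noteq> {}" for a b
  proof -
    have "(- (a + b) * w, - a * b * w) \<in> parabola_line w a \<inter> parabola_line w b"
      by (auto simp: parabola_line_def algebra_simps power2_eq_square)
    then show ?thesis by auto
  qed
  have no_triple: False
    if "a \<noteq> b" "b \<noteq> c" "a \<noteq> c" "q \<in> parabola_line w a" "q \<in> parabola_line w b" "q \<in> parabola_line w c"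
    for a b c q
  proof -
    obtain x y where "q = (x, y)" by (cases q)
    with that have e: "y = a * x + a\<^sup>2 * w" "y = b * x + b\<^sup>2 * w" "y = c * x + c\<^sup>2 * w"
      by (auto simp: parabola_line_def)
    have "(a - b) * (x + (a + b) * w) = 0" "(a - c) * (x + (a + c) * w) = 0"
      using e by (auto simp: algebra_simps power2_eq_square)
    with that have "x + (a + b) * w = 0" "x + (a + c) * w = 0" by auto
    moreover have "(b - c) * w = (x + (a + b) * w) - (x + (a + c) * w)"
      by (simp add: algebra_simps)
    ultimately have "(b - c) * w = 0" by simp
    with that assms show False by simp
  qed
  show ?thesis
    unfolding general_position_def pairwise_def parallel_lines_def
  proof (intro conjI ballI impI)
    fix l m k
    assume "l \<in> parabola_line w ` A" "m \<in> parabola_line w ` A" "k \<in> parabola_line w ` A"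
      and "l \<noteq> m \<and> m \<noteq> k \<and> l \<noteq> k"
    then obtain a b c where "l = parabola_line w a" "m = parabola_line w b" "k = parabola_line w c"
      "a \<noteq> b" "b \<noteq> c" "a \<noteq> c" by blast
    then show "l \<inter> m \<inter> k = {}" using no_triple[of a b c] by blast
  qed (use meet in blast)
qed

section \<open>Divisors lost under multiplication\<close>

text \<open>A divisor \<open>u\<close> lost under \<open>p * q\<close> is lost under
  \<open>q\<close> already, or \<open>q * u\<close> is a divisor lost under \<open>p\<close>;
  multiplication by \<open>q\<close> is injective.\<close>

lemma card_nondivisors_mult_le:
  fixes B p q :: nat
  assumes "B > 0" "q > 0"
  shows "card {u. u dvd B \<and> \<not> p * q * u dvd B}
    \<le> card {u. u dvd B \<and> \<not> p * u dvd B} + card {u. u dvd B \<and> \<not> q * u dvd B}"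
proof -
  let ?P = "{u. u dvd B \<and> \<not> p * u dvd B}" and ?Q = "{u. u dvd B \<and> \<not> q * u dvd B}"
  let ?R = "{u. u dvd B \<and> q * u dvd B \<and> \<not> p * (q * u) dvd B}"
  have fin: "finite ?P" "finite ?Q" "finite ?R" using assms by auto
  have "card ?R \<le> card ?P"
    by (rule card_inj_on_le[of "(*) q"]) (use assms fin in \<open>auto simp: inj_on_def\<close>)
  have "card {u. u dvd B \<and> \<not> p * q * u dvd B} \<le> card (?R \<union> ?Q)"
    using fin by (intro card_mono) (auto simp: mult.assoc)
  also have "\<dots> \<le> card ?R + card ?Q" by (rule card_Un_le)
  finally show ?thesis using \<open>card ?R \<le> card ?P\<close> by simp
qed

lemma card_nondivisors_prime_le:
  fixes B p :: nat
  assumes B: "B > 0" and p: "prime p"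
  shows "card {u. u dvd B \<and> \<not> p * u dvd B} * (multiplicity p B + 1) \<le> card {u. u dvd B}"
proof -
  define V where "V = multiplicity p B"
  obtain B' where B': "B = p ^ V * B'" "\<not> p dvd B'"
    unfolding V_def using multiplicity_decompose'[of B p] B p not_prime_unit by blast
  have "B' > 0" using B B' by (cases B') auto
  let ?W = "{w. w dvd B'}"
  have finW: "finite ?W" using \<open>B' > 0\<close> by simp
  have pw: "\<not> p dvd w" if "w \<in> ?W" for w using that B' dvd_trans by blast
  \<comment> \<open>The bad divisors are the tops of the chains \<open>w, p w, \<dots>, p ^ V w\<close> with \<open>w dvd B'\<close>.\<close>
  have "{u. u dvd B \<and> \<not> p * u dvd B} \<subseteq> (\<lambda>w. p ^ V * w) ` ?W"
  proof
    fix u assume "u \<in> {u. u dvd B \<and> \<not> p * u dvd B}"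
    then have u: "u dvd B" "\<not> p * u dvd B" by auto
    then have "u \<noteq> 0" using B by auto
    define j where "j = multiplicity p u"
    obtain w where w: "u = p ^ j * w" "\<not> p dvd w"
      unfolding j_def using multiplicity_decompose'[of u p] \<open>u \<noteq> 0\<close> p not_prime_unit by blast
    have "coprime w (p ^ V)"
      using w p by (metis coprime_commute coprime_power_right_iff prime_imp_coprime)
    moreover have "w dvd p ^ V * B'" using u w B' by (metis dvd_mult_right)
    ultimately have wB: "w dvd B'" by (simp add: coprime_dvd_mult_right_iff)
    have "j \<le> V"
      unfolding j_def V_def using u B by (intro dvd_imp_multiplicity_le) auto
    moreover have "\<not> j < V"
    proof
      assume "j < V"
      then have "p ^ Suc j * w dvd p ^ V * B'"
        using wB by (intro mult_dvd_mono le_imp_power_dvd) auto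
      with u w B' show False by (simp add: mult.assoc)
    qed
    ultimately have "j = V" by simp
    with w wB show "u \<in> (\<lambda>w. p ^ V * w) ` ?W" by auto
  qed
  then have "card {u. u dvd B \<and> \<not> p * u dvd B} \<le> card ?W"
    by (rule surj_card_le[OF finW])
  \<comment> \<open>Each of the \<open>card ?W\<close> chains has \<open>V + 1\<close> members, and
    distinct chains are disjoint: the multiplicity of \<open>p\<close> and the cofactor identify a
    member.\<close>
  moreover have "card ?W * (V + 1) \<le> card {u. u dvd B}"
  proof -
    have inj: "inj_on (\<lambda>(w, j). p ^ j * w) (?W \<times> {..V})"
    proof (rule inj_onI, clarify)
      fix w j w' j' assume a: "w dvd B'" "w' dvd B'" "p ^ j * w = p ^ j' * w'"
      have m: "multiplicity p (p ^ i * v) = i" if "v dvd B'" for v i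
        using pw[of v] that p \<open>B' > 0\<close>
        by (subst prime_elem_multiplicity_mult_distrib)
          (auto simp: not_dvd_imp_multiplicity_0 multiplicity_same_power dest: prime_gt_0_nat)
      have "j = j'" using m a by metis
      with a p show "w = w' \<and> j = j'" by (auto dest: prime_gt_0_nat)
    qed
    have "(\<lambda>(w, j). p ^ j * w) ` (?W \<times> {..V}) \<subseteq> {u. u dvd B}"
      unfolding B'(1) by (auto intro!: mult_dvd_mono le_imp_power_dvd)
    then have "card (?W \<times> {..V}) \<le> card {u. u dvd B}"
      using inj B by (intro card_inj_on_le) auto
    then show ?thesis by (simp add: card_cartesian_product)
  qed
  ultimately show ?thesis unfolding V_def[symmetric]
    by (meson le_trans mult_le_mono1)
qed

text \<open>The last hypothesis gives \<open>ln x \<le> (multiplicity p B + 1) * ln p\<close>, which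
  settles primes. Subadditivity of the losses and additivity of \<open>ln\<close> carry the bound
  along the factorisation of \<open>i\<close>.\<close>

lemma card_nondivisors_ln_le:
  fixes B x i :: nat
  assumes B: "B > 0" and "x > 0" and "i > 0"
    and "\<And>p. prime p \<Longrightarrow> p dvd i \<Longrightarrow> x < p ^ (multiplicity p B + 1)"
  shows "real (card {u. u dvd B \<and> \<not> i * u dvd B}) * ln (real x) \<le> real (card {u. u dvd B}) * ln (real i)"
  using assms(3,4)
proof (induction i rule: prime_divisors_induct)
  case (unit i)
  then have "i = 1" by simp
  then show ?case by simp
next
  case (factor p i)
  have p: "prime p" and i: "i > 0" using factor by auto
  let ?b = "\<lambda>i. real (card {u. u dvd B \<and> \<not> i * u dvd B})" and ?t = "real (card {u. u dvd B})"
  have IH: "?b i * ln (real x) \<le> ?t * ln (real i)"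
    using factor i by auto
  have "x < p ^ (multiplicity p B + 1)" using factor(4)[of p] p by simp
  then have "real x \<le> real (p ^ (multiplicity p B + 1))" unfolding of_nat_le_iff by simp
  then have "?b p * ln (real x) \<le> ?b p * ln (real (p ^ (multiplicity p B + 1)))"
    using \<open>x > 0\<close> by (intro mult_left_mono ln_mono) auto
  also have "\<dots> = real (card {u. u dvd B \<and> \<not> p * u dvd B} * (multiplicity p B + 1)) * ln (real p)"
    unfolding of_nat_power using p by (subst ln_realpow) (auto simp: prime_gt_0_nat algebra_simps simp del: power_Suc)
  also have "\<dots> \<le> ?t * ln (real p)"
    using card_nondivisors_prime_le[OF B p] prime_gt_0_nat[OF p]
    by (intro mult_right_mono) (auto simp del: of_nat_mult of_nat_add simp: Suc_le_eq)
  finally have P: "?b p * ln (real x) \<le> ?t * ln (real p)" .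
  have "?b (p * i) \<le> ?b p + ?b i"
    using card_nondivisors_mult_le[OF B i, of p] by linarith
  then have "?b (p * i) * ln (real x) \<le> (?b p + ?b i) * ln (real x)"
    using \<open>x > 0\<close> by (intro mult_right_mono) auto
  also have "\<dots> \<le> ?t * ln (real p) + ?t * ln (real i)"
    using P IH by (simp add: algebra_simps)
  also have "\<dots> = ?t * ln (real (p * i))"
    using i prime_gt_0_nat[OF p] by (simp add: ln_mult algebra_simps)
  finally show ?case .
qed simp

text \<open>The number of primes is bounded crudely by \<open>k\<close>. For
  \<open>x = k ^ L\<close> this gives \<open>ln B \<le> k * L * ln k\<close>, and the factor
  \<open>ln k\<close> becomes the \<open>ln (ln N)\<close> of the theorem.\<close>

lemma exists_smooth_number:
  fixes k x :: nat
  assumes "x > 0"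
  obtains B where "B > 0" "B \<le> x ^ k"
    "\<And>p. prime p \<Longrightarrow> p \<le> k \<Longrightarrow> x < p ^ (multiplicity p B + 1)"
proof -
  have "\<forall>p. \<exists>v. prime p \<longrightarrow> p ^ v \<le> x \<and> x < p ^ (v + 1)"
    using ex_power_ivl1[of _ x] assms prime_ge_2_nat by (metis One_nat_def Suc_leI)
  then obtain v where v: "\<And>p. prime p \<Longrightarrow> p ^ v p \<le> x \<and> x < p ^ (v p + 1)"
    by metis
  let ?P = "{p. prime p \<and> p \<le> k}"
  define B where "B = (\<Prod>p\<in>?P. p ^ v p)"
  have fin: "finite ?P" by simp
  have cP: "card ?P \<le> k"
  proof -
    have "?P \<subseteq> {1..k}" by (auto dest: prime_gt_0_nat)
    then have "card ?P \<le> card {1..k}" by (intro card_mono) auto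
    then show ?thesis by simp
  qed
  have "B > 0" unfolding B_def by (auto intro!: prod_pos dest: prime_gt_0_nat)
  moreover have "B \<le> x ^ k"
  proof -
    have "B \<le> (\<Prod>p\<in>?P. x)" unfolding B_def by (intro prod_mono) (use v in auto)
    also have "\<dots> \<le> x ^ k" using cP assms by (auto intro: power_increasing)
    finally show ?thesis .
  qed
  moreover have "x < p ^ (multiplicity p B + 1)" if p: "prime p" "p \<le> k" for p
  proof -
    have "multiplicity p B = v p"
      unfolding B_def using that by (subst multiplicity_prod_prime_powers) auto
    then show ?thesis using v[OF p(1)] by simp
  qed
  ultimately show ?thesis using that by blast
qed

section \<open>The set and its near-invariance under the maps given by the lines\<close>

text \<open>Makes the representation \<open>u (1 + B m)\<close> unique.\<close>

lemma gcd_smooth_part: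
  fixes B u m :: nat
  assumes "u dvd B"
  shows "gcd (u * (1 + B * m)) B = u"
proof -
  have "coprime (1 + B * m) B"
    using gcd_add_mult[of B m 1] by (simp add: coprime_iff_gcd_eq_1 gcd.commute add.commute mult.commute)
  then have "gcd (u * (1 + B * m)) B = gcd u B"
    by (intro gcd_mult_left_right_cancel) (simp add: coprime_commute)
  then show ?thesis using assms by (simp add: gcd_nat.absorb1)
qed

definition smooth_progression :: "nat \<Rightarrow> nat \<Rightarrow> nat set" where
  "smooth_progression B M = (\<lambda>(u, m). u * (1 + B * m)) ` ({u. u dvd B} \<times> {..<M})"

lemma smooth_progressionI:
  "u dvd B \<Longrightarrow> m < M \<Longrightarrow> u * (1 + B * m) \<in> smooth_progression B M"
  unfolding smooth_progression_def by (rule image_eqI[of _ _ "(u, m)"]) auto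

lemma inj_on_smooth_progression:
  fixes B M :: nat
  assumes "B > 0"
  shows "inj_on (\<lambda>(u, m). u * (1 + B * m)) ({u. u dvd B} \<times> {..<M})"
proof (rule inj_onI, clarify)
  fix u m u' m' :: nat
  assume a: "u dvd B" "u' dvd B" "u * (1 + B * m) = u' * (1 + B * m')"
  then have "u = u'" using gcd_smooth_part by metis
  with a assms show "u = u' \<and> m = m'" by auto
qed

lemma card_smooth_progression:
  assumes "B > 0"
  shows "card (smooth_progression B M) = card {u. u dvd B} * M"
  unfolding smooth_progression_def card_image[OF inj_on_smooth_progression[OF assms]]
  by (simp add: card_cartesian_product)

text \<open>With \<open>B = i * u * d\<close>, the shift \<open>i\<^sup>2 * B\<^sup>2\<close> equals
  \<open>i * u * B * (d * i\<^sup>2)\<close>, so it raises \<open>m\<close> by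
  \<open>d * i\<^sup>2 \<le> B * k\<close>. Only the last \<open>B * k\<close> values of
  \<open>m\<close> are given up; for \<open>M \<le> B * k\<close> truncated subtraction makes the
  bound trivial.\<close>

lemma card_smooth_progression_invariant:
  fixes B M i k :: nat
  assumes B: "B > 0" and i: "i > 0" "i \<le> k"
  shows "card {u. u dvd B \<and> i * u dvd B} * (M - B * k)
    \<le> card {x \<in> smooth_progression B M. i * x + i\<^sup>2 * B\<^sup>2 \<in> smooth_progression B M}"
proof -
  let ?D = "{u. u dvd B \<and> i * u dvd B} \<times> {..<M - B * k}"
  let ?f = "\<lambda>(u, m). u * (1 + B * m)"
  have "?f ` ?D \<subseteq> {x \<in> smooth_progression B M. i * x + i\<^sup>2 * B\<^sup>2 \<in> smooth_progression B M}"
  proof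
    fix z assume "z \<in> ?f ` ?D"
    then obtain u m where z: "z = u * (1 + B * m)"
      and um: "u dvd B" "i * u dvd B" "m < M - B * k" by auto
    then obtain d where d: "B = i * u * d" by (auto simp: dvd_def)
    have "d * i \<le> B" using d B by (cases u) auto
    then have "d * i\<^sup>2 \<le> B * k"
      using i(2) mult_le_mono[of "d * i" B i k] by (simp add: power2_eq_square mult.assoc)
    then have "m + d * i\<^sup>2 < M" using um by auto
    moreover have "i * (u * (1 + B * m)) + i\<^sup>2 * B\<^sup>2 = (i * u) * (1 + B * (m + d * i\<^sup>2))"
    proof -
      have "i\<^sup>2 * B\<^sup>2 = i\<^sup>2 * B * (i * u * d)" using d by (simp add: power2_eq_square)
      then show ?thesis by (simp add: algebra_simps)
    qed
    ultimately show "z \<in> {x \<in> smooth_progression B M. i * x + i\<^sup>2 * B\<^sup>2 \<in> smooth_progression B M}"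
      unfolding z using um smooth_progressionI[of u B m M] smooth_progressionI[of "i * u" B "m + d * i\<^sup>2" M]
      by simp
  qed
  moreover have "inj_on ?f ?D"
    by (rule inj_on_subset[OF inj_on_smooth_progression[OF B, of M]]) auto
  moreover have "finite (smooth_progression B M)"
    using B by (simp add: smooth_progression_def)
  ultimately have "card ?D \<le> card {x \<in> smooth_progression B M. i * x + i\<^sup>2 * B\<^sup>2 \<in> smooth_progression B M}"
    by (intro card_inj_on_le) auto
  then show ?thesis by (simp add: card_cartesian_product)
qed

section \<open>Transfer to the rationals\<close>

lemma rich_parabola_line:
  fixes S :: "nat set"
  assumes fin: "finite S"
    and "\<alpha> * real (card S) \<le> real (card {x \<in> S. i * x + i\<^sup>2 * w \<in> S})"
  shows "rich ((of_nat :: nat \<Rightarrow> rat) ` S) \<alpha> (parabola_line (of_nat w) (of_nat i))"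
proof -
  let ?Y = "(of_nat :: nat \<Rightarrow> rat) ` S"
  let ?G = "{x \<in> S. i * x + i\<^sup>2 * w \<in> S}"
  let ?g = "\<lambda>x. (rat_of_nat x, rat_of_nat (i * x + i\<^sup>2 * w))"
  have "card ?G \<le> card (parabola_line (of_nat w) (of_nat i) \<inter> ?Y \<times> ?Y)"
  proof (rule card_inj_on_le[of ?g])
    show "inj_on ?g ?G" by (auto simp: inj_on_def)
    show "?g ` ?G \<subseteq> parabola_line (of_nat w) (of_nat i) \<inter> ?Y \<times> ?Y"
      by (auto simp: parabola_line_def simp del: of_nat_add of_nat_mult)
        (simp_all add: of_nat_add of_nat_mult)
    show "finite (parabola_line (of_nat w) (of_nat i) \<inter> ?Y \<times> ?Y)" using fin by auto
  qed
  moreover have "card ?Y = card S" by (intro card_image) (auto simp: inj_on_def)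
  ultimately show ?thesis using assms(2) unfolding rich_def by simp
qed

text \<open>Leaves a problem about natural numbers only: a set of size \<open>N\<close> that is
  almost invariant under each of \<open>k\<close> affine maps.\<close>

lemma RLGP_field_rat_ge:
  fixes S :: "nat set"
  assumes "finite S" "card S = N" "N > 0" "\<alpha> > 0" "w > 0"
    and "\<And>i. i \<in> {1..k} \<Longrightarrow> \<alpha> * real N \<le> real (card {x \<in> S. i * x + i\<^sup>2 * w \<in> S})"
  shows "k \<le> RLGP_field TYPE(rat) N \<alpha>"
proof -
  let ?L = "parabola_line (rat_of_nat w) ` (of_nat ` {1..k})"
  have "card ?L = k"
    by (simp add: card_image[OF inj_on_subset[OF inj_parabola_line subset_UNIV]] card_image inj_on_def)
  moreover have "card ?L \<le> RLGP_field TYPE(rat) N \<alpha>"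
  proof (rule RLGP_field_ge)
    show "finite (rat_of_nat ` S)" using assms by simp
    show "card (rat_of_nat ` S) = N" using assms by (subst card_image) (auto simp: inj_on_def)
    show "\<forall>l\<in>?L. is_line l \<and> rich (rat_of_nat ` S) \<alpha> l"
      using assms by (auto simp: is_line_parabola_line intro!: rich_parabola_line)
    show "general_position ?L" using assms by (intro general_position_parabola_line) auto
  qed (use assms in auto)
  ultimately show ?thesis by simp
qed

section \<open>Counting for suitable parameters\<close>

text \<open>Two losses occur, each at most \<open>(1 - \<alpha>) / 2 * N\<close>. The term
  \<open>t * (1 + B * k)\<close> covers rounding \<open>N\<close> to a multiple of \<open>t\<close>
  and the last \<open>B * k\<close> values of \<open>m\<close>; the term \<open>b * M\<close> covers
  the divisors lost under \<open>i\<close>. The first is controlled by the size of \<open>N\<close>,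
  the second by that of \<open>L\<close>.\<close>

lemma RLGP_field_rat_ge_power:
  fixes k L N :: nat and \<alpha> :: real
  assumes \<alpha>: "0 < \<alpha>" and k: "k \<ge> 2" and L: "2 \<le> (1 - \<alpha>) * real L" and N: "k ^ (5 * L * k) \<le> N"
  shows "k \<le> RLGP_field TYPE(rat) N \<alpha>"
proof -
  have "L > 0" using L by (cases L) auto
  have \<delta>: "0 < 1 - \<alpha>" using L by (smt (verit) mult_nonpos_nonneg of_nat_0_le_iff)
  obtain B where B: "B > 0" "B \<le> (k ^ L) ^ k"
    "\<And>p. prime p \<Longrightarrow> p \<le> k \<Longrightarrow> k ^ L < p ^ (multiplicity p B + 1)"
    using exists_smooth_number[of "k ^ L" k] k by auto
  define t where "t = card {u. u dvd B}"
  have t0: "t > 0" unfolding t_def using B by (auto simp: card_gt_0_iff)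
  have tB: "t \<le> B"
  proof -
    have "{u. u dvd B} \<subseteq> {1..B}" using B by (auto intro: dvd_imp_le simp: Suc_le_eq dvd_pos_nat)
    then have "t \<le> card {1..B}" unfolding t_def by (intro card_mono) auto
    then show ?thesis by simp
  qed
  define M where "M = N div t"
  have "N > 0" using N k by (smt (verit) gr0I le_zero_eq power_eq_0_iff not_numeral_le_zero)
  have cY: "card (smooth_progression B M) = t * M"
    using card_smooth_progression[OF B(1)] by (simp add: t_def)
  have finY: "finite (smooth_progression B M)" using B by (simp add: smooth_progression_def)
  have "t * M \<le> N" by (simp add: M_def)
  \<comment> \<open>Numbers below \<open>N\<close> pad the progression to exactly \<open>N\<close>
    elements; enlarging the set cannot decrease the count of points on a line.\<close>
  then obtain S where S: "smooth_progression B M \<subseteq> S" "finite S" "card S = N"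
  proof -
    have "N \<le> card (smooth_progression B M \<union> {..<N})"
      using card_mono[of "smooth_progression B M \<union> {..<N}" "{..<N}"] finY by simp
    with \<open>t * M \<le> N\<close> cY finY obtain S where "smooth_progression B M \<subseteq> S"
      "S \<subseteq> smooth_progression B M \<union> {..<N}" "card S = N"
      using exists_subset_between[of "smooth_progression B M" N "smooth_progression B M \<union> {..<N}"] by auto
    moreover from this have "finite S" using finY finite_subset[of S] by blast
    ultimately show ?thesis using that by blast
  qed
  have small: "real t * (1 + real B * real k) \<le> (1 - \<alpha>) / 2 * real N"
  proof -
    \<comment> \<open>Origin of the exponent: \<open>L \<le> k ^ L\<close>,
      \<open>2 * k \<le> k\<^sup>2\<close> and \<open>B\<^sup>2 \<le> k ^ (2 * L * k)\<close> give
      \<open>L + 2 + 2 * L * k\<close>, which is at most \<open>5 * L * k\<close>.\<close>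
    have "t * (1 + B * k) \<le> B * (2 * (B * k))"
      using tB B(1) k by (intro mult_le_mono) (auto simp: Suc_le_eq)
    also have "\<dots> = 2 * k * (B * B)" by simp
    also have "\<dots> \<le> 2 * k * ((k ^ L) ^ k * (k ^ L) ^ k)"
      using B(2) by (intro mult_le_mono) auto
    also have "\<dots> \<le> k * k * ((k ^ L) ^ k * (k ^ L) ^ k)"
      using k by (intro mult_le_mono) auto
    finally have "t * (1 + B * k) \<le> k * k * ((k ^ L) ^ k * (k ^ L) ^ k)" .
    moreover have "L \<le> k ^ L"
      using k less_exp[of L] power_mono[of 2 k L] by linarith
    ultimately have "L * (t * (1 + B * k)) \<le> k ^ L * (k * k * ((k ^ L) ^ k * (k ^ L) ^ k))"
      by (metis mult_le_mono)
    also have "\<dots> = k ^ (L + 2 + (L * k + L * k))"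
      by (simp only: power_add power_mult power2_eq_square mult.assoc)
    also have "\<dots> \<le> k ^ (5 * L * k)"
    proof (rule power_increasing)
      have "2 \<le> L * k" "L \<le> L * k" using k \<open>L > 0\<close> mult_le_mono[of 1 L 2 k] by auto
      then show "L + 2 + (L * k + L * k) \<le> 5 * L * k" unfolding mult.assoc by linarith
    qed (use k in auto)
    also note N
    finally have *: "real L * (real t * (1 + real B * real k)) \<le> real N"
      by (metis of_nat_1 of_nat_add of_nat_le_iff of_nat_mult)
    have "2 * (real t * (1 + real B * real k)) \<le> (1 - \<alpha>) * real L * (real t * (1 + real B * real k))"
      using L by (intro mult_right_mono) auto
    also have "\<dots> \<le> (1 - \<alpha>) * real N"
      using * \<delta> by (simp add: mult.assoc)
    finally show ?thesis by simp
  qed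
  have "\<alpha> * real N \<le> real (card {x \<in> S. i * x + i\<^sup>2 * B\<^sup>2 \<in> S})" if i: "i \<in> {1..k}" for i
  proof -
    define b where "b = card {u. u dvd B \<and> \<not> i * u dvd B}"
    define g where "g = card {u. u dvd B \<and> i * u dvd B}"
    have "t = card ({u. u dvd B \<and> i * u dvd B} \<union> {u. u dvd B \<and> \<not> i * u dvd B})"
      unfolding t_def by (rule arg_cong[where f = card]) auto
    also have "\<dots> = g + b"
      unfolding b_def g_def using B by (intro card_Un_disjoint) auto
    finally have tgb: "t = g + b" .
    have "real b * ln (real (k ^ L)) \<le> real t * ln (real i)"
      unfolding b_def t_def
      using B i k by (intro card_nondivisors_ln_le) (auto dest: dvd_imp_le)
    also have "\<dots> \<le> real t * ln (real k)"
      using i by (intro mult_left_mono) auto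
    \<comment> \<open>Since \<open>ln (k ^ L) = L * ln k\<close>, the logarithms cancel and a
      proportion of at most \<open>1 / L\<close> is lost.\<close>
    finally have "real b * real L * ln (real k) \<le> real t * ln (real k)"
      using k by (simp add: ln_realpow mult.assoc)
    moreover have "ln (real k) > 0" using k by simp
    ultimately have bL: "real b * real L \<le> real t" by simp
    have "2 * real b \<le> (1 - \<alpha>) * real L * real b"
      using L by (intro mult_right_mono) auto
    also have "\<dots> \<le> (1 - \<alpha>) * real t"
      using bL \<delta> by (simp add: mult_ac)
    finally have b2: "real b \<le> (1 - \<alpha>) / 2 * real t" by simp
    have "real b * real M \<le> (1 - \<alpha>) / 2 * (real t * real M)"
      using mult_right_mono[OF b2, of "real M"] by (simp add: mult_ac)
    also have "\<dots> \<le> (1 - \<alpha>) / 2 * real N"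
      using \<open>t * M \<le> N\<close> \<delta> by (intro mult_left_mono) (auto simp flip: of_nat_mult)
    finally have bM: "real b * real M \<le> (1 - \<alpha>) / 2 * real N" .
    have "N < t * M + t"
      unfolding M_def using t0 by (metis add.commute div_mult_mod_eq mod_less_divisor mult.commute nat_add_left_cancel_less)
    then have NM: "real N \<le> real t * real M + real t"
      by (metis less_imp_le of_nat_add of_nat_le_iff of_nat_mult)
    have "\<alpha> * real N \<le> real N - real t * (1 + real B * real k) - real b * real M"
      using bM small by (simp add: algebra_simps)
    also have "\<dots> \<le> real t * real M - real t * (real B * real k) - real b * real M"
      using NM by (simp add: algebra_simps)
    \<comment> \<open>After substituting \<open>t = g + b\<close>, the term \<open>b * B * k\<close>
      is dropped.\<close>
    also have "\<dots> \<le> real g * (real M - real B * real k)"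
      unfolding tgb by (simp add: algebra_simps)
    also have "\<dots> \<le> real (g * (M - B * k))"
    proof -
      \<comment> \<open>Truncation only helps: \<open>real (M - B * k)\<close> is at least the real
        difference, also when \<open>M < B * k\<close>.\<close>
      have "M \<le> (M - B * k) + B * k" by simp
      then have "real M \<le> real (M - B * k) + real B * real k"
        by (metis of_nat_add of_nat_le_iff of_nat_mult)
      then show ?thesis unfolding of_nat_mult by (intro mult_left_mono) auto
    qed
    also have "\<dots> \<le> real (card {x \<in> smooth_progression B M. i * x + i\<^sup>2 * B\<^sup>2 \<in> smooth_progression B M})"
      unfolding g_def of_nat_le_iff
      by (rule card_smooth_progression_invariant[OF B(1)]) (use i in auto)
    also have "\<dots> \<le> real (card {x \<in> S. i * x + i\<^sup>2 * B\<^sup>2 \<in> S})"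
      unfolding of_nat_le_iff using S by (intro card_mono) auto
    finally show ?thesis .
  qed
  then show ?thesis
    using S \<open>N > 0\<close> \<alpha> B(1) by (intro RLGP_field_rat_ge[of S N \<alpha> "B\<^sup>2"]) auto
qed

section \<open>From \<open>k\<close> to \<open>N\<close>, and the absolute constant\<close>

text \<open>Serves the ranges in which the claimed bound is at most 1. A single horizontal axis is
  fully rich in any grid whose side contains 0.\<close>

lemma RLGP_field_rat_pos:
  assumes "N > 0" "0 < \<alpha>" "\<alpha> \<le> 1"
  shows "1 \<le> RLGP_field TYPE(rat) N \<alpha>"
proof -
  let ?Y = "rat_of_nat ` {..<N}" and ?l = "{(x :: rat, y :: rat). y = 0}"
  have cY: "card ?Y = N" by (subst card_image) (auto simp: inj_on_def)
  have "card {?l} \<le> RLGP_field TYPE(rat) N \<alpha>"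
  proof (rule RLGP_field_ge)
    have "is_line ?l"
      unfolding is_line_def by (rule exI[of _ 0], rule exI[of _ 1], rule exI[of _ 0]) auto
    moreover have "?l \<inter> ?Y \<times> ?Y = ?Y \<times> {0}" using assms(1) by (auto intro: image_eqI[of _ _ 0])
    then have "rich ?Y \<alpha> ?l"
      unfolding rich_def using assms cY by (simp add: card_cartesian_product mult_left_le_one_le)
    ultimately show "\<forall>l\<in>{?l}. is_line l \<and> rich ?Y \<alpha> l" by simp
  qed (use assms cY in \<open>auto simp: general_position_def\<close>)
  then show ?thesis by simp
qed

lemma RLGP_field_rat_ge_ln:
  fixes N :: nat and \<alpha> :: real
  assumes \<alpha>: "0 < \<alpha>" "\<alpha> < 1" and N: "N > 0" and ll: "ln (ln (real N)) \<ge> 1"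
  shows "1 / 30 * (1 - \<alpha>) * (ln (real N) / ln (ln (real N))) \<le> real (RLGP_field TYPE(rat) N \<alpha>)"
proof -
  \<comment> \<open>Here 15 is 5 times 3, with 5 from the exponent \<open>5 * L * k\<close> and 3
    from \<open>L \<le> 3 / (1 - \<alpha>)\<close>. The constant \<open>1 / 30\<close> loses another
    factor 2 to the rounding of \<open>x \<ge> 2\<close> down to \<open>k\<close>.\<close>
  define x where "x = (1 - \<alpha>) / 15 * (ln (real N) / ln (ln (real N)))"
  define k where "k = nat \<lfloor>x\<rfloor>"
  have lnN: "ln (real N) > 0" using ll N by (cases "N = 1") auto
  have lnN1: "ln (real N) > 1" using ll ln_gt_zero_iff[OF lnN] by linarith
  have goal: "1 / 30 * (1 - \<alpha>) * (ln (real N) / ln (ln (real N))) = x / 2"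
    by (simp add: x_def)
  show ?thesis
  proof (cases "x < 2")
    case True
    then show ?thesis using RLGP_field_rat_pos[of N \<alpha>] assms unfolding goal by linarith
  next
    case False
    then have k2: "k \<ge> 2" and kx: "real k \<le> x" and xk: "x / 2 \<le> real k"
      unfolding k_def by (auto simp: le_nat_iff le_floor_iff) linarith
    define L where "L = nat \<lceil>2 / (1 - \<alpha>)\<rceil>"
    have L1: "2 / (1 - \<alpha>) \<le> real L" unfolding L_def by linarith
    have "real L \<le> 2 / (1 - \<alpha>) + 1" unfolding L_def using \<alpha> by (simp add: nat_ceiling_le_eq)
    also have "\<dots> \<le> 2 / (1 - \<alpha>) + 1 / (1 - \<alpha>)" using \<alpha> by (intro add_left_mono) simp
    also have "\<dots> = 3 / (1 - \<alpha>)" by (simp flip: add_divide_distrib)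
    finally have L3: "real L \<le> 3 / (1 - \<alpha>)" .
    \<comment> \<open>Allows \<open>ln k\<close> to be replaced by \<open>ln (ln N)\<close>; this is
      where \<open>ln (ln N) \<ge> 1\<close> enters.\<close>
    have "x \<le> ln (real N)"
    proof -
      have q: "ln (real N) / ln (ln (real N)) \<le> ln (real N)"
        using divide_left_mono[of 1 "ln (ln (real N))" "ln (real N)"] ll lnN lnN1
        by simp
      have "x \<le> 1 * (ln (real N) / ln (ln (real N)))"
        unfolding x_def using \<alpha> ll lnN lnN1 by (intro mult_right_mono divide_nonneg_nonneg) auto
      with q show ?thesis by simp
    qed
    then have "ln (real k) \<le> ln (ln (real N))"
      using kx k2 lnN by (subst ln_le_cancel_iff) auto
    then have "real k * ln (real k) \<le> x * ln (ln (real N))"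
      using kx k2 ll by (intro mult_mono) auto
    also have "\<dots> = (1 - \<alpha>) / 15 * ln (real N)" using ll by (simp add: x_def)
    finally have kk: "real k * ln (real k) \<le> (1 - \<alpha>) / 15 * ln (real N)" .
    have "ln (real (k ^ (5 * L * k))) = 5 * real L * (real k * ln (real k))"
      using k2 by (simp add: ln_realpow)
    also have "\<dots> \<le> 5 * (3 / (1 - \<alpha>)) * ((1 - \<alpha>) / 15 * ln (real N))"
      by (rule mult_mono[OF mult_left_mono[OF L3] kk]) (use k2 \<alpha> in auto)
    also have "\<dots> = ln (real N)" using \<alpha> by (simp add: field_simps)
    finally have "k ^ (5 * L * k) \<le> N"
      using k2 N by (subst (asm) ln_le_cancel_iff) (auto simp flip: of_nat_power)
    moreover have "2 \<le> (1 - \<alpha>) * real L" using L1 \<alpha> by (simp add: field_simps)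
    ultimately have "k \<le> RLGP_field TYPE(rat) N \<alpha>"
      using \<alpha> k2 by (intro RLGP_field_rat_ge_power) auto
    then show ?thesis using xk unfolding goal by linarith
  qed
qed

text \<open>Strictness yields \<open>ln 3 > 1\<close> and so \<open>ln (ln 3) > 0\<close>. The
  seventh power is large enough, as \<open>(6 / 7) ^ 7 > 1 / 3\<close>.\<close>

lemma exp_one_less_3: "exp 1 < (3::real)"
proof -
  have "6 / 7 \<le> exp (- 1 / 7 :: real)" using exp_ge_add_one_self[of "- 1 / 7 :: real"] by simp
  then have "(6 / 7) ^ 7 \<le> exp (- 1 / 7 :: real) ^ 7" by (intro power_mono) auto
  also have "\<dots> = exp (- 1)" by (simp flip: exp_of_nat_mult)
  also have "\<dots> = inverse (exp 1)" by (rule exp_minus)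
  finally show ?thesis by (simp add: field_simps)
qed

theorem theorem1p2:
  shows "\<exists>C::real. C > 0 \<and>
    (\<forall>\<alpha>::real. 0 < \<alpha> \<and> \<alpha> < 1 \<longrightarrow>
      (\<forall>N::nat. N > 0 \<longrightarrow>
        real (RLGP_field TYPE(rat) N \<alpha>)
          \<ge> C * (1 - \<alpha>) * (ln (real N) / ln (ln (real N)))))"
proof -
  \<comment> \<open>The least positive value of \<open>ln (ln N)\<close>, attained at
    \<open>N = 3\<close>.\<close>
  define c :: real where "c = ln (ln 3)"
  have "ln (3::real) > 1"
    using exp_one_less_3 ln_less_cancel_iff[of "exp 1" 3] by simp
  then have c: "c > 0" by (simp add: c_def)
  \<comment> \<open>The value \<open>1 / 30\<close> serves \<open>ln (ln N) \<ge> 1\<close>. For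
    \<open>0 < ln (ln N) < 1\<close> the quotient of logarithms is at most \<open>3 / c\<close>, so
    \<open>c / 3\<close> brings the bound down to 1.\<close>
  define C where "C = min (1 / 30) (c / 3)"
  have C: "C > 0" "C \<le> 1 / 30" "C \<le> c / 3" using c by (auto simp: C_def)
  show ?thesis
  proof (intro exI[of _ C] conjI allI impI)
    fix \<alpha> :: real and N :: nat
    assume "0 < \<alpha> \<and> \<alpha> < 1" and N: "N > 0"
    then have \<alpha>: "0 < \<alpha>" "\<alpha> < 1" by auto
    \<comment> \<open>For \<open>N \<le> 2\<close> the right-hand side is not positive, since \<open>ln (ln N)\<close> is negative or (for \<open>N = 1\<close>)
      the junk value \<open>ln 0 = 0\<close>; hence the first case below.\<close>
    let ?q = "ln (real N) / ln (ln (real N))"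
    have lnN: "ln (real N) \<ge> 0" using N by simp
    consider "ln (ln (real N)) \<le> 0" | "0 < ln (ln (real N))" "ln (ln (real N)) < 1" | "ln (ln (real N)) \<ge> 1"
      by linarith
    then show "C * (1 - \<alpha>) * ?q \<le> real (RLGP_field TYPE(rat) N \<alpha>)"
    proof cases
      case 1
      then have "C * (1 - \<alpha>) * ?q \<le> 0"
        using C \<alpha> lnN by (intro mult_nonneg_nonpos) (auto simp: divide_nonneg_nonpos)
      then show ?thesis by (smt (verit) of_nat_0_le_iff)
    next
      case 2
      have pos: "ln (real N) > 1"
        using 2 lnN by (cases "ln (real N) = 0") auto
      then have "real N > exp 1" using N pos by (metis exp_less_cancel_iff exp_ln of_nat_0_less_iff)
      then have "real N > 2" using exp_ge_add_one_self[of 1] by linarith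
      then have N3: "N \<ge> 3" by simp
      have "ln 3 \<le> ln (real N)" using N3 by simp
      then have "c \<le> ln (ln (real N))"
        unfolding c_def using \<open>ln 3 > 1\<close> by (subst ln_le_cancel_iff) auto
      moreover have "ln (real N) \<le> 3"
      proof -
        have "ln (real N) < exp 1" using 2 pos by (metis exp_less_mono exp_ln less_trans zero_less_one)
        then show ?thesis using exp_le by simp
      qed
      ultimately have q: "?q \<le> 3 / c" "?q \<ge> 0" using c lnN by (auto intro!: frac_le)
      have "C * (1 - \<alpha>) * ?q \<le> (c / 3) * 1 * (3 / c)"
        using C q \<alpha> c by (intro mult_mono) auto
      then show ?thesis using c RLGP_field_rat_pos[of N \<alpha>] N \<alpha> by simp
    next
      case 3
      then have "C * (1 - \<alpha>) * ?q \<le> 1 / 30 * (1 - \<alpha>) * ?q"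
        using C \<alpha> lnN by (intro mult_right_mono) auto
      then show ?thesis using RLGP_field_rat_ge_ln[OF \<alpha> N 3] by linarith
    qed
  qed (fact C)
qed

end
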